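(* Let $(A,\succ_A,\prec_A)$ and $(V,\succ_V,\prec_V)$ be two anti-dendriform algebras. Then any extension $$0\longrightarrow V\stackrel{i}{\longrightarrow}E\stackrel{p}{\longrightarrow}A\longrightarrow0$$ of $A$ by $V$ is cohomologous to a crossed product extension $$0\longrightarrow V\stackrel{i_V}{\longrightarrow}A\sharp V\stackrel{\pi_A}{\longrightarrow}A\longrightarrow0,$$ where $i_V(a)=(0,a)$ and $\pi_A(x,a)=x$.
   Context: All vector spaces and algebras are over a field $k$, and all algebras are finite-dimensional. An anti-dendriform algebra $(A,\succ,\prec)$ is a vector space with two bilinear maps $\succ,\prec:A\times A\to A$ such that, writing $x\cdot y=x\succ y+x\prec y$, for all $x,y,z$: $x\succ(y\succ z)=-(x\cdot y)\succ z=-x\prec(y\cdot z)=(x\prec y)\prec z$ and $(x\succ y)\prec z=x\succ(y\prec z)$. Homomorphisms preserve both operations. A (non-abelian) extension of $A$ by $V$ is an anti-dendriform algebra $E$ with a short exact sequence $0\to V\to E\to A\to 0$ of anti-dendriform algebras. Two extensions $E_1,E_2$ of $A$ by $V$, with maps $i_1,p_1$ and $i_2,p_2$, are cohomologous if there is an isomorphism of anti-dendriform algebras $\varphi:E_1\to E_2$ with $\varphi i_1=i_2$ and $p_2\varphi=p_1$. A crossed product $A\sharp V$ is the vector space $A\oplus V$ with operations $$(x,a)\succeq(y,b)=(x\succ_A y,\ \omega_1(x,y)+l_{\succ}(x)b+r_{\succ}(y)a+a\succ_V b),$$ $$(x,a)\preceq(y,b)=(x\prec_A y,\ \omega_2(x,y)+l_{\prec}(x)b+r_{\prec}(y)a+a\prec_V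 b),$$ for some linear maps $l_{\succ},r_{\succ},l_{\prec},r_{\prec}:A\to\mathrm{End}(V)$ and bilinear maps $\omega_1,\omega_2:A\times A\to V$ such that $(A\oplus V,\succeq,\preceq)$ is an anti-dendriform algebra. *)

theory Defs
  imports "HOL-Analysis.Product_Vector"
begin

text \<open>
  Vector spaces are given by a scalar multiplication on a type, as in
  \<^theory>\<open>HOL.Vector_Spaces\<close>; the field $k$ is the type of scalars.
\<close>

locale anti_dendriform_algebra = vector_space scale
  for scale :: "'k::field \<Rightarrow> 'a::ab_group_add \<Rightarrow> 'a" +
  fixes succ :: "'a \<Rightarrow> 'a \<Rightarrow> 'a" (infixl \<open>\<succ>\<close> 70)
    and prec :: "'a \<Rightarrow> 'a \<Rightarrow> 'a" (infixl \<open>\<prec>\<close> 70)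
  assumes finite_dim: "\<exists>B. finite_dimensional_vector_space scale B"
    and succ_linear_right: "Vector_Spaces.linear scale scale (\<lambda>y. x \<succ> y)"
    and succ_linear_left: "Vector_Spaces.linear scale scale (\<lambda>x. x \<succ> y)"
    and prec_linear_right: "Vector_Spaces.linear scale scale (\<lambda>y. x \<prec> y)"
    and prec_linear_left: "Vector_Spaces.linear scale scale (\<lambda>x. x \<prec> y)"
    \<comment> \<open>\<open>u \<succ> v + u \<prec> v\<close> is the product \<open>u \<cdot> v\<close>\<close>
    and succ_succ: "x \<succ> (y \<succ> z) = - ((x \<succ> y + x \<prec> y) \<succ> z)"
    and dot_succ: "- ((x \<succ> y + x \<prec> y) \<succ> z) = - (x \<prec> (y \<succ> z + y \<prec> z))"
    and prec_dot: "- (x \<prec> (y \<succ> z + y \<prec> z)) = (x \<prec> y) \<prec> z"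
    and succ_prec: "(x \<succ> y) \<prec> z = x \<succ> (y \<prec> z)"

locale anti_dendriform_hom =
  dom: anti_dendriform_algebra s1 succ1 prec1 +
  cod: anti_dendriform_algebra s2 succ2 prec2 +
  Vector_Spaces.linear s1 s2 f
  for s1 :: "'k::field \<Rightarrow> 'a::ab_group_add \<Rightarrow> 'a" and succ1 prec1
    and s2 :: "'k \<Rightarrow> 'b::ab_group_add \<Rightarrow> 'b" and succ2 prec2
    and f :: "'a \<Rightarrow> 'b" +
  assumes map_succ: "f (succ1 x y) = succ2 (f x) (f y)"
    and map_prec: "f (prec1 x y) = prec2 (f x) (f y)"

definition anti_dendriform_iso ::
  "('k::field \<Rightarrow> 'a::ab_group_add \<Rightarrow> 'a) \<Rightarrow> ('a \<Rightarrow> 'a \<Rightarrow> 'a) \<Rightarrow> ('a \<Rightarrow> 'a \<Rightarrow> 'a)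
   \<Rightarrow> ('k \<Rightarrow> 'b::ab_group_add \<Rightarrow> 'b) \<Rightarrow> ('b \<Rightarrow> 'b \<Rightarrow> 'b) \<Rightarrow> ('b \<Rightarrow> 'b \<Rightarrow> 'b)
   \<Rightarrow> ('a \<Rightarrow> 'b) \<Rightarrow> bool" where
  "anti_dendriform_iso s1 succ1 prec1 s2 succ2 prec2 f \<longleftrightarrow>
     anti_dendriform_hom s1 succ1 prec1 s2 succ2 prec2 f \<and> bij f"

locale anti_dendriform_extension =
  i: anti_dendriform_hom sV succV precV sE succE precE i +
  p: anti_dendriform_hom sE succE precE sA succA precA p
  for sA :: "'k::field \<Rightarrow> 'a::ab_group_add \<Rightarrow> 'a" and succA precA
    and sV :: "'k \<Rightarrow> 'v::ab_group_add \<Rightarrow> 'v" and succV precV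
    and sE :: "'k \<Rightarrow> 'e::ab_group_add \<Rightarrow> 'e" and succE precE
    and i :: "'v \<Rightarrow> 'e" and p :: "'e \<Rightarrow> 'a" +
  assumes inj_i: "inj i"
    and exact: "range i = {e. p e = 0}"
    and surj_p: "surj p"

locale cohomologous =
  ext1: anti_dendriform_extension sA succA precA sV succV precV sE1 succE1 precE1 i1 p1 +
  ext2: anti_dendriform_extension sA succA precA sV succV precV sE2 succE2 precE2 i2 p2
  for sA :: "'k::field \<Rightarrow> 'a::ab_group_add \<Rightarrow> 'a" and succA precA
    and sV :: "'k \<Rightarrow> 'v::ab_group_add \<Rightarrow> 'v" and succV precV
    and sE1 :: "'k \<Rightarrow> 'e::ab_group_add \<Rightarrow> 'e" and succE1 precE1
    and i1 :: "'v \<Rightarrow> 'e" and p1 :: "'e \<Rightarrow> 'a"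
    and sE2 :: "'k \<Rightarrow> 'f::ab_group_add \<Rightarrow> 'f" and succE2 precE2
    and i2 :: "'v \<Rightarrow> 'f" and p2 :: "'f \<Rightarrow> 'a" +
  assumes ex_iso: "\<exists>\<phi>. anti_dendriform_iso sE1 succE1 precE1 sE2 succE2 precE2 \<phi> \<and>
    \<phi> \<circ> i1 = i2 \<and> p2 \<circ> \<phi> = p1"

text \<open>Linear maps $A \to \mathrm{End}(V)$, for the pointwise operations on $\mathrm{End}(V)$.\<close>

definition linear_into_End ::
  "('k::field \<Rightarrow> 'a::ab_group_add \<Rightarrow> 'a) \<Rightarrow> ('k \<Rightarrow> 'v::ab_group_add \<Rightarrow> 'v)
   \<Rightarrow> ('a \<Rightarrow> 'v \<Rightarrow> 'v) \<Rightarrow> bool" where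
  "linear_into_End sA sV l \<longleftrightarrow>
     (\<forall>x. Vector_Spaces.linear sV sV (l x)) \<and>
     (\<forall>x y. l (x + y) = (\<lambda>b. l x b + l y b)) \<and>
     (\<forall>c x. l (sA c x) = (\<lambda>b. sV c (l x b)))"

definition bilinear_into ::
  "('k::field \<Rightarrow> 'a::ab_group_add \<Rightarrow> 'a) \<Rightarrow> ('k \<Rightarrow> 'v::ab_group_add \<Rightarrow> 'v)
   \<Rightarrow> ('a \<Rightarrow> 'a \<Rightarrow> 'v) \<Rightarrow> bool" where
  "bilinear_into sA sV \<omega> \<longleftrightarrow>
     (\<forall>x. Vector_Spaces.linear sA sV (\<lambda>y. \<omega> x y)) \<and>
     (\<forall>y. Vector_Spaces.linear sA sV (\<lambda>x. \<omega> x y))"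

text \<open>One formula serves both operations of \<open>A \<sharp> V\<close>, with $(\omega_1, l_\succ, r_\succ)$
  and $(\omega_2, l_\prec, r_\prec)$ respectively.\<close>

definition crossed_op ::
  "('a \<Rightarrow> 'a \<Rightarrow> 'a) \<Rightarrow> ('v::ab_group_add \<Rightarrow> 'v \<Rightarrow> 'v) \<Rightarrow> ('a \<Rightarrow> 'a \<Rightarrow> 'v)
   \<Rightarrow> ('a \<Rightarrow> 'v \<Rightarrow> 'v) \<Rightarrow> ('a \<Rightarrow> 'v \<Rightarrow> 'v) \<Rightarrow> 'a \<times> 'v \<Rightarrow> 'a \<times> 'v \<Rightarrow> 'a \<times> 'v" where
  "crossed_op opA opV \<omega> l r = (\<lambda>(x, a) (y, b). (opA x y, \<omega> x y + l x b + r y a + opV a b))"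

definition crossed_product ::
  "('k::field \<Rightarrow> 'a::ab_group_add \<Rightarrow> 'a) \<Rightarrow> ('a \<Rightarrow> 'a \<Rightarrow> 'a) \<Rightarrow> ('a \<Rightarrow> 'a \<Rightarrow> 'a)
   \<Rightarrow> ('k \<Rightarrow> 'v::ab_group_add \<Rightarrow> 'v) \<Rightarrow> ('v \<Rightarrow> 'v \<Rightarrow> 'v) \<Rightarrow> ('v \<Rightarrow> 'v \<Rightarrow> 'v)
   \<Rightarrow> ('a \<Rightarrow> 'v \<Rightarrow> 'v) \<Rightarrow> ('a \<Rightarrow> 'v \<Rightarrow> 'v) \<Rightarrow> ('a \<Rightarrow> 'v \<Rightarrow> 'v) \<Rightarrow> ('a \<Rightarrow> 'v \<Rightarrow> 'v)
   \<Rightarrow> ('a \<Rightarrow> 'a \<Rightarrow> 'v) \<Rightarrow> ('a \<Rightarrow> 'a \<Rightarrow> 'v) \<Rightarrow> bool" where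
  "crossed_product sA succA precA sV succV precV l_succ r_succ l_prec r_prec \<omega>1 \<omega>2 \<longleftrightarrow>
     linear_into_End sA sV l_succ \<and> linear_into_End sA sV r_succ \<and>
     linear_into_End sA sV l_prec \<and> linear_into_End sA sV r_prec \<and>
     bilinear_into sA sV \<omega>1 \<and> bilinear_into sA sV \<omega>2 \<and>
     anti_dendriform_algebra (module_prod.scale sA sV)
       (crossed_op succA succV \<omega>1 l_succ r_succ) (crossed_op precA precV \<omega>2 l_prec r_prec)"

end

theory Submission
  imports Defs
begin

text \<open>
  Over a field the surjection \<open>p\<close> has a linear section \<open>s\<close>. It need not respect the products, but
  it makes the underlying sequence of vector spaces split: there is a linear retraction \<open>q\<close> of \<open>i\<close>
  with \<open>s \<circ> p + i \<circ> q = id\<close>, so that \<open>\<phi> = (p, q)\<close> is a linear isomorphism from \<open>E\<close> onto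
  \<open>A \<times> V\<close> with inverse \<open>(x, a) \<mapsto> s x + i a\<close>.

  Carrying a product \<open>\<circ>\<close> of \<open>E\<close> along \<open>\<phi>\<close> gives a crossed product. Expanding
  \<open>(s x + i a) \<circ> (s y + i b)\<close> by bilinearity, \<open>p\<close> sees only \<open>x\<close> and \<open>y\<close>, since it is multiplicative
  and kills \<open>i\<close>, while \<open>q\<close> yields four terms: the last one, \<open>q (i a \<circ> i b)\<close>, is the product of
  \<open>V\<close>, since \<open>i\<close> is multiplicative, and the other three serve as the definitions of \<open>\<omega> x y\<close>,
  \<open>l x b\<close> and \<open>r y a\<close> (lemma \<open>crossed_op_transport\<close>). The anti-dendriform identities and
  finite-dimensionality pass along the isomorphism (lemma \<open>anti_dendriform_iso_transport\<close>), and
  \<open>\<phi>\<close> is compatible with the inclusions of \<open>V\<close> and the projections to \<open>A\<close> by construction.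
\<close>

text \<open>
  A linear map that is multiplicative and onto carries every identity between the operations to its
  target, and a linear bijection carries a finite basis to a finite basis. That the target is
  an anti-dendriform algebra is thus a conclusion, which is how the crossed product gets its axioms.
\<close>

lemma anti_dendriform_iso_transport:
  assumes alg: "anti_dendriform_algebra s1 succ1 prec1"
    and lin: "Vector_Spaces.linear s1 s2 f"
    and bij: "bij f"
    and fs: "\<And>x y. f (succ1 x y) = succ2 (f x) (f y)"
    and fp: "\<And>x y. f (prec1 x y) = prec2 (f x) (f y)"
  shows "anti_dendriform_iso s1 succ1 prec1 s2 succ2 prec2 f"
proof -
  interpret A: anti_dendriform_algebra s1 succ1 prec1 by (rule alg)
  interpret f: Vector_Spaces.linear s1 s2 f by (rule lin)
  have onto: "\<exists>x. u = f x" for u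
    using bij by (metis bij_pointE)
  have fin: "\<exists>B. finite_dimensional_vector_space s2 B"
  proof -
    obtain B where "finite_dimensional_vector_space s1 B"
      using A.finite_dim by blast
    then interpret B: finite_dimensional_vector_space s1 B .
    have "finite_dimensional_vector_space s2 (f ` B)"
    proof
      show "finite (f ` B)"
        using B.finite_Basis by simp
      show "f.vs2.independent (f ` B)"
        by (rule f.independent_injective_image[OF B.independent_Basis])
          (use bij in \<open>auto intro: inj_on_subset dest: bij_is_inj\<close>)
      show "f.vs2.span (f ` B) = UNIV"
        using bij by (simp add: f.span_image B.span_Basis bij_is_surj)
    qed
    then show ?thesis by blast
  qed
  have "anti_dendriform_algebra s2 succ2 prec2"
  proof (unfold_locales, rule fin)
    \<comment> \<open>each identity is the image under \<open>f\<close> of the same identity between preimages\<close>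
    note to_image = fs[symmetric] fp[symmetric] f.add[symmetric] f.neg[symmetric] f.scale[symmetric]
    note succ_lin = A.succ_linear_right[unfolded Vector_Spaces.linear_iff] A.succ_linear_left[unfolded Vector_Spaces.linear_iff]
    note prec_lin = A.prec_linear_right[unfolded Vector_Spaces.linear_iff] A.prec_linear_left[unfolded Vector_Spaces.linear_iff]
    fix u v w c
    obtain x y z where uvw: "u = f x" "v = f y" "w = f z"
      using onto by metis
    show "succ2 u (v + w) = succ2 u v + succ2 u w"
      "succ2 u (s2 c v) = s2 c (succ2 u v)"
      "succ2 (v + w) u = succ2 v u + succ2 w u"
      "succ2 (s2 c v) u = s2 c (succ2 v u)"
      by (simp_all only: uvw to_image) (simp_all add: succ_lin)
    show "prec2 u (v + w) = prec2 u v + prec2 u w"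
      "prec2 u (s2 c v) = s2 c (prec2 u v)"
      "prec2 (v + w) u = prec2 v u + prec2 w u"
      "prec2 (s2 c v) u = s2 c (prec2 v u)"
      by (simp_all only: uvw to_image) (simp_all add: prec_lin)
    show "succ2 u (succ2 v w) = - (succ2 (succ2 u v + prec2 u v) w)"
      by (simp only: uvw to_image A.succ_succ[of x y z])
    show "- (succ2 (succ2 u v + prec2 u v) w) = - (prec2 u (succ2 v w + prec2 v w))"
      by (simp only: uvw to_image A.dot_succ[of x y z])
    show "- (prec2 u (succ2 v w + prec2 v w)) = prec2 (prec2 u v) w"
      by (simp only: uvw to_image A.prec_dot[of x y z])
    show "prec2 (succ2 u v) w = succ2 u (prec2 v w)"
      by (simp only: uvw to_image A.succ_prec[of x y z])
  qed
  then interpret B: anti_dendriform_algebra s2 succ2 prec2 .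
  have "anti_dendriform_hom s1 succ1 prec1 s2 succ2 prec2 f"
    by unfold_locales (simp_all add: fs fp)
  then show ?thesis
    using bij by (simp add: anti_dendriform_iso_def)
qed

text \<open>
  A split short exact sequence of vector spaces, presented as a biproduct diagram: exactness
  is expressed by equations between the four maps, which serve as rewrite rules.
\<close>

locale linear_splitting =
  i: Vector_Spaces.linear sV sE i + p: Vector_Spaces.linear sE sA p +
  s: Vector_Spaces.linear sA sE s + q: Vector_Spaces.linear sE sV q
  for sA :: "'k::field \<Rightarrow> 'a::ab_group_add \<Rightarrow> 'a"
    and sV :: "'k \<Rightarrow> 'v::ab_group_add \<Rightarrow> 'v"
    and sE :: "'k \<Rightarrow> 'e::ab_group_add \<Rightarrow> 'e"
    and i p s q +
  assumes p_i [simp]: "p (i a) = 0"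
    and p_s [simp]: "p (s x) = x"
    and q_i [simp]: "q (i a) = a"
    and q_s [simp]: "q (s x) = 0"
    and decomp: "s (p e) + i (q e) = e"
begin

sublocale prod: vector_space_prod sA sV ..

lemma linear_pair: "Vector_Spaces.linear sE prod.scale (\<lambda>e. (p e, q e))"
  by unfold_locales (simp_all add: prod.scale_prod p.add q.add p.scale q.scale)

lemma bij_pair: "bij (\<lambda>e. (p e, q e))"
proof (rule bij_betw_byWitness[where f' = "\<lambda>(x, a). s x + i a"])
  show "\<forall>e\<in>UNIV. (case (p e, q e) of (x, a) \<Rightarrow> s x + i a) = e"
    by (simp add: decomp)
  show "\<forall>u\<in>UNIV. (p (case u of (x, a) \<Rightarrow> s x + i a), q (case u of (x, a) \<Rightarrow> s x + i a)) = u"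
    by (simp add: split_beta p.add q.add)
qed auto

text \<open>
  The maps \<open>\<omega>\<close>, \<open>l\<close> and \<open>r\<close> are the \<open>V\<close>-components of the product on the blocks \<open>A \<times> A\<close>,
  \<open>A \<times> V\<close> and \<open>V \<times> A\<close>. On \<open>V \<times> V\<close> the \<open>V\<close>-component is \<open>opV\<close>, because \<open>i\<close> is multiplicative; the
  \<open>A\<close>-component depends on \<open>A \<times> A\<close> only, because \<open>p\<close> is multiplicative.
\<close>

lemma crossed_op_transport:
  assumes opE: "bilinear_into sE sE opE"
    and i_op: "\<And>a b. i (opV a b) = opE (i a) (i b)"
    and p_op: "\<And>e f. p (opE e f) = opA (p e) (p f)"
  obtains \<omega> l r where
    "bilinear_into sA sV \<omega>" "linear_into_End sA sV l" "linear_into_End sA sV r"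
    "\<And>e f. (p (opE e f), q (opE e f)) = crossed_op opA opV \<omega> l r (p e, q e) (p f, q f)"
proof
  let ?\<omega> = "\<lambda>x y. q (opE (s x) (s y))"
  let ?l = "\<lambda>x b. q (opE (s x) (i b))"
  let ?r = "\<lambda>y a. q (opE (i a) (s y))"
  have add: "opE e (f + g) = opE e f + opE e g" "opE (f + g) e = opE f e + opE g e"
    and scale: "opE e (sE c f) = sE c (opE e f)" "opE (sE c f) e = sE c (opE f e)" for c e f g
    using opE by (simp_all add: bilinear_into_def Vector_Spaces.linear_iff)
  note lin = add scale i.add i.scale s.add s.scale q.add q.scale
  show "bilinear_into sA sV ?\<omega>"
    unfolding bilinear_into_def Vector_Spaces.linear_iff
    by (simp add: lin p.vs2.vector_space_axioms i.vs1.vector_space_axioms)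
  show "linear_into_End sA sV ?l" "linear_into_End sA sV ?r"
    unfolding linear_into_End_def Vector_Spaces.linear_iff
    by (simp_all add: lin i.vs1.vector_space_axioms)
  fix e f
  have "q (opE e f) = q (opE (s (p e) + i (q e)) (s (p f) + i (q f)))"
    by (simp only: decomp)
  also have "\<dots> = ?\<omega> (p e) (p f) + ?l (p e) (q f) + ?r (p f) (q e) + q (opE (i (q e)) (i (q f)))"
    by (simp add: add q.add algebra_simps)
  also have "q (opE (i (q e)) (i (q f))) = opV (q e) (q f)"
    by (simp flip: i_op)
  finally show "(p (opE e f), q (opE e f)) = crossed_op opA opV ?\<omega> ?l ?r (p e, q e) (p f, q f)"
    by (simp add: crossed_op_def p_op)
qed

end

text \<open>
  The retraction that belongs to a section \<open>s\<close> sends \<open>e\<close> to the unique preimage under \<open>i\<close> of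
  \<open>e - s (p e)\<close>, which lies in the kernel of \<open>p\<close> and hence, by exactness, in the image of \<open>i\<close>.
\<close>

lemma short_exact_sequence_splits:
  assumes i: "Vector_Spaces.linear sV sE i" and p: "Vector_Spaces.linear sE sA p"
    and inj: "inj i" and exact: "range i = {e. p e = 0}" and surj: "surj p"
  obtains s q where "linear_splitting sA sV sE i p s q"
proof -
  interpret i: Vector_Spaces.linear sV sE i by (rule i)
  interpret p: Vector_Spaces.linear sE sA p by (rule p)
  interpret pair: vector_space_pair sE sA ..
  obtain s where s: "Vector_Spaces.linear sA sE s" and "p \<circ> s = id"
    using pair.linear_surjective_right_inverse[OF p surj] by blast
  interpret s: Vector_Spaces.linear sA sE s by (rule s)
  have ps: "p (s x) = x" for x
    using \<open>p \<circ> s = id\<close> by (simp add: fun_eq_iff)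
  have pi: "p (i a) = 0" for a
    using exact by blast
  define q where "q e = inv i (e - s (p e))" for e
  have iq: "i (q e) = e - s (p e)" for e
    unfolding q_def by (rule f_inv_into_f) (simp add: exact p.diff ps)
  \<comment> \<open>\<open>i\<close> being injective and linear, every equation about \<open>q\<close> may be checked after applying \<open>i\<close>\<close>
  note via_i = injD[OF inj]
  have "linear_splitting sA sV sE i p s q"
  proof unfold_locales
    show "q (e + f) = q e + q f" for e f
      by (rule via_i) (simp add: iq i.add p.add s.add)
    show "q (sE c e) = sV c (q e)" for c e
      by (rule via_i) (simp add: iq i.scale p.scale s.scale i.vs2.scale_right_diff_distrib)
    show "q (i a) = a" for a
      by (rule via_i) (simp add: iq pi)
    show "q (s x) = 0" for x
      by (rule via_i) (simp add: iq ps)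
    show "s (p e) + i (q e) = e" for e
      by (simp add: iq)
  qed (simp_all add: ps pi)
  then show thesis by (rule that)
qed

theorem theorem4p7:
  fixes sA :: "'k::field \<Rightarrow> 'a::ab_group_add \<Rightarrow> 'a"
    and succA precA :: "'a \<Rightarrow> 'a \<Rightarrow> 'a"
    and sV :: "'k \<Rightarrow> 'v::ab_group_add \<Rightarrow> 'v"
    and succV precV :: "'v \<Rightarrow> 'v \<Rightarrow> 'v"
    and sE :: "'k \<Rightarrow> 'e::ab_group_add \<Rightarrow> 'e"
    and succE precE :: "'e \<Rightarrow> 'e \<Rightarrow> 'e"
    and i :: "'v \<Rightarrow> 'e" and p :: "'e \<Rightarrow> 'a"
  assumes "anti_dendriform_algebra sA succA precA"
    and "anti_dendriform_algebra sV succV precV"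
    and "anti_dendriform_extension sA succA precA sV succV precV sE succE precE i p"
  shows "\<exists>l_succ r_succ l_prec r_prec \<omega>1 \<omega>2.
    crossed_product sA succA precA sV succV precV l_succ r_succ l_prec r_prec \<omega>1 \<omega>2 \<and>
    cohomologous sA succA precA sV succV precV
      sE succE precE i p
      (module_prod.scale sA sV)
      (crossed_op succA succV \<omega>1 l_succ r_succ) (crossed_op precA precV \<omega>2 l_prec r_prec)
      (\<lambda>a. (0, a)) (\<lambda>(x, a). x)"
proof -
  interpret E: anti_dendriform_extension sA succA precA sV succV precV sE succE precE i p
    by (rule assms(3))
  obtain s q where "linear_splitting sA sV sE i p s q"
    by (rule short_exact_sequence_splits[OF E.i.linear_axioms E.p.linear_axioms
          E.inj_i E.exact E.surj_p])
  then interpret S: linear_splitting sA sV sE i p s q .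
  let ?\<phi> = "\<lambda>e. (p e, q e)"
  have "bilinear_into sE sE succE" "bilinear_into sE sE precE"
    using E.i.cod.succ_linear_right E.i.cod.succ_linear_left
      E.i.cod.prec_linear_right E.i.cod.prec_linear_left
    by (simp_all add: bilinear_into_def)
  obtain \<omega>1 l_succ r_succ where succ:
    "bilinear_into sA sV \<omega>1" "linear_into_End sA sV l_succ" "linear_into_End sA sV r_succ"
    "\<And>e f. ?\<phi> (succE e f) = crossed_op succA succV \<omega>1 l_succ r_succ (?\<phi> e) (?\<phi> f)"
    by (rule S.crossed_op_transport[OF \<open>bilinear_into sE sE succE\<close> E.i.map_succ E.p.map_succ]) (rule that)
  obtain \<omega>2 l_prec r_prec where prec:
    "bilinear_into sA sV \<omega>2" "linear_into_End sA sV l_prec" "linear_into_End sA sV r_prec"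
    "\<And>e f. ?\<phi> (precE e f) = crossed_op precA precV \<omega>2 l_prec r_prec (?\<phi> e) (?\<phi> f)"
    by (rule S.crossed_op_transport[OF \<open>bilinear_into sE sE precE\<close> E.i.map_prec E.p.map_prec]) (rule that)
  let ?succ = "crossed_op succA succV \<omega>1 l_succ r_succ"
  let ?prec = "crossed_op precA precV \<omega>2 l_prec r_prec"
  have iso: "anti_dendriform_iso sE succE precE S.prod.scale ?succ ?prec ?\<phi>"
    by (rule anti_dendriform_iso_transport)
      (fact E.i.cod.anti_dendriform_algebra_axioms S.linear_pair S.bij_pair succ(4) prec(4))+
  then interpret \<phi>: anti_dendriform_hom sE succE precE S.prod.scale ?succ ?prec ?\<phi>
    by (simp add: anti_dendriform_iso_def)
  have crossed: "crossed_product sA succA precA sV succV precV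
      l_succ r_succ l_prec r_prec \<omega>1 \<omega>2"
    using succ(1-3) prec(1-3) \<phi>.cod.anti_dendriform_algebra_axioms
    by (simp add: crossed_product_def)
  have inclusion: "?\<phi> \<circ> i = (\<lambda>a. (0, a))"
    by (simp add: fun_eq_iff)
  have projection: "(\<lambda>(x, a). x) \<circ> ?\<phi> = p"
    by (simp add: fun_eq_iff)
  \<comment> \<open>the inclusion of \<open>V\<close> is a homomorphism because it is \<open>\<phi> \<circ> i\<close>; the projection to \<open>A\<close> is one
    because the first component of \<open>crossed_op\<close> is the product of \<open>A\<close>\<close>
  have ext: "anti_dendriform_extension sA succA precA sV succV precV S.prod.scale ?succ ?prec
      (\<lambda>a. (0, a)) (\<lambda>(x, a). x)"
  proof unfold_locales
    show "(0, succV a b) = ?succ (0, a) (0, b)" for a b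
      using succ(4)[of "i a" "i b"] by (simp flip: E.i.map_succ)
    show "(0, precV a b) = ?prec (0, a) (0, b)" for a b
      using prec(4)[of "i a" "i b"] by (simp flip: E.i.map_prec)
  qed (auto simp: crossed_op_def S.prod.scale_def inj_on_def surj_def)
  have "cohomologous sA succA precA sV succV precV sE succE precE i p
      S.prod.scale ?succ ?prec (\<lambda>a. (0, a)) (\<lambda>(x, a). x)"
    using iso inclusion projection E.anti_dendriform_extension_axioms ext
    by (auto simp: cohomologous_def cohomologous_axioms_def)
  with crossed show ?thesis by blast
qed

end
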